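(* Let $n \ge 1$ be an integer. For any integer $k \geq 1$, the even-indexed power sum $S_{2k}$ is given by $$S_{2k} = \frac{1}{2} \sum \frac{(2k)!}{b_1! b_2! \cdots b_k!} \prod_{r=1}^{k} \left( \frac{1}{4^r (2r)!} \right)^{b_r} 2^m\, m! \binom{2n+m+1}{2m+1},$$ where the sum is over all $k$-tuples of nonnegative integers $(b_1,b_2,\ldots,b_k)$ satisfying the constraint $b_1 + 2b_2 + \cdots + k b_k = k$, and where $m = b_1 + b_2 +\cdots +b_k$.
   Context: For integers $m \ge 0$ and $n \ge 1$, $S_m = 1^m + 2^m + \cdots + n^m$ denotes the sum of the $m$th powers of the first $n$ positive integers (the dependence on $n$ is suppressed in the notation). *)

theory Defs
  imports Complex_Main "HOL-Library.FuncSet"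
begin

definition power_sum :: "nat \<Rightarrow> nat \<Rightarrow> nat" where
  "power_sum n m = (\<Sum>i = 1..n. i ^ m)"

text \<open>
  A \<open>k\<close>-tuple \<open>(b\<^sub>1, \<dots>, b\<^sub>k)\<close> of nonnegative integers is a function on the index set
  \<open>{1..k}\<close>, made unique by extensionality outside of it.
\<close>

definition weighted_tuples :: "nat \<Rightarrow> (nat \<Rightarrow> nat) set" where
  "weighted_tuples k = {b \<in> {1..k} \<rightarrow>\<^sub>E UNIV. (\<Sum>r = 1..k. r * b r) = k}"

lemma finite_weighted_tuples: "finite (weighted_tuples k)"
proof (rule finite_subset)
  show "weighted_tuples k \<subseteq> {1..k} \<rightarrow>\<^sub>E {..k}"
  proof
    fix b assume b: "b \<in> weighted_tuples k"
    have "b r \<le> k" if r: "r \<in> {1..k}" for r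
    proof -
      have "b r \<le> r * b r" using r by simp
      also have "\<dots> \<le> (\<Sum>r = 1..k. r * b r)"
        by (rule member_le_sum[OF r]) auto
      also have "\<dots> = k" using b by (simp add: weighted_tuples_def)
      finally show ?thesis .
    qed
    with b show "b \<in> {1..k} \<rightarrow>\<^sub>E {..k}"
      by (auto simp: weighted_tuples_def PiE_iff)
  qed
  show "finite ({1..k} \<rightarrow>\<^sub>E {..k})"
    by (rule finite_PiE) auto
qed

end

theory Submission
  imports Defs "HOL-Computational_Algebra.Formal_Power_Series"
begin

text \<open>
  Both sides are coefficients of one formal power series in \<open>t\<close>. Up to the factor
  \<open>2 / (2 * k)!\<close>, the power sum \<open>1\<^sup>2\<^sup>k + \<dots> + n\<^sup>2\<^sup>k\<close> is the coefficient of \<open>t\<^sup>2\<^sup>k\<close> in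
  \<open>1 + (\<Sum>i = 1..n. 2 * cosh (i * t))\<close>; this is the Dirichlet kernel
  \<open>sinh ((2 * n + 1) * t / 2) / sinh (t / 2)\<close>, hence a polynomial of Chebyshev type in
  \<open>y = 2 * cosh (t / 2) - 2\<close>, namely
  \<open>\<Sum>m. ((2 * n + 1 + m) choose (2 * m + 1)) * y\<^sup>m\<close>.

  Pascal's rule shows that these polynomials, for all \<open>N\<close> in place of \<open>2 * n + 1\<close>, satisfy
  the three-term recurrence with multiplier \<open>2 + y = 2 * cosh (t / 2)\<close> (\<open>cheb_rec\<close>). The
  functions \<open>2 * cosh (N * t / 2)\<close> satisfy the same recurrence by the addition theorem, and
  comparison of initial values gives \<open>cheb_diff_two_cosh\<close>, which telescopes to
  \<open>cheb_odd_two_cosh\<close>.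

  Since \<open>y = 2 * (\<Sum>r \<ge> 1. t\<^sup>2\<^sup>r / (4\<^sup>r * (2 * r)!))\<close>, the multinomial theorem expands the
  coefficient of \<open>t\<^sup>2\<^sup>k\<close> in \<open>y\<^sup>m\<close> as a sum over the tuples \<open>b\<close> of total \<open>m\<close> and weight
  \<open>(\<Sum>r = 1..k. r * b r) = k\<close> (\<open>even_fps_power_nth\<close>). Summing over \<open>m\<close> gives the formula.
\<close>

unbundle fps_syntax

section \<open>The multinomial theorem\<close>

definition compositions :: "'i set \<Rightarrow> nat \<Rightarrow> ('i \<Rightarrow> nat) set" where
  "compositions A m = {b \<in> A \<rightarrow>\<^sub>E UNIV. (\<Sum>i\<in>A. b i) = m}"

lemma finite_compositions:
  assumes "finite A"
  shows "finite (compositions A m)"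
proof (rule finite_subset)
  show "compositions A m \<subseteq> A \<rightarrow>\<^sub>E {..m}"
    using assms by (auto simp: compositions_def PiE_iff extensional_def intro: member_le_sum)
  show "finite (A \<rightarrow>\<^sub>E {..m})"
    using assms by (intro finite_PiE) auto
qed

text \<open>
  Multinomial coefficients are integers, so the truncating division in the multinomial
  theorem below is exact.
\<close>

lemma prod_fact_dvd_fact_sum:
  fixes b :: "'i \<Rightarrow> nat"
  assumes "finite A"
  shows "(\<Prod>i\<in>A. fact (b i)) dvd (fact (\<Sum>i\<in>A. b i) :: nat)"
  using assms
proof (induction A rule: finite_induct)
  case (insert a A)
  have "fact (b a) * (\<Prod>i\<in>A. fact (b i)) dvd fact (b a) * (fact (\<Sum>i\<in>A. b i) :: nat)"
    using insert.IH by (rule mult_dvd_mono[OF dvd_refl])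
  also have "\<dots> dvd fact (b a + (\<Sum>i\<in>A. b i))"
    by (rule fact_fact_dvd_fact)
  finally show ?case using insert.hyps by simp
qed simp

text \<open>
  A composition over \<open>insert a A\<close> is determined by its entry \<open>j\<close> at \<open>a\<close> and a composition of
  the rest \<open>m - j\<close> over \<open>A\<close>: this carries the induction step of the multinomial theorem.
\<close>

lemma sum_compositions_insert:
  assumes "finite A" and "a \<notin> A"
  shows "(\<Sum>b\<in>compositions (insert a A) m. h b) =
    (\<Sum>j\<le>m. \<Sum>g\<in>compositions A (m - j). h (g(a := j)))"
proof -
  have "(\<Sum>b\<in>compositions (insert a A) m. h b) =
      (\<Sum>(j, g)\<in>(SIGMA j:{..m}. compositions A (m - j)). h (g(a := j)))"
  proof (rule sum.reindex_bij_witness[where i = "\<lambda>(j, g). g(a := j)"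
        and j = "\<lambda>b. (b a, b(a := undefined))"])
    fix b assume "b \<in> compositions (insert a A) m"
    hence b: "b \<in> insert a A \<rightarrow>\<^sub>E UNIV" and m: "b a + (\<Sum>i\<in>A. b i) = m"
      using assms by (auto simp: compositions_def)
    have "(\<Sum>i\<in>A. (b(a := undefined)) i) = (\<Sum>i\<in>A. b i)"
      using assms by (intro sum.cong) auto
    with b m show "(b a, b(a := undefined)) \<in> (SIGMA j:{..m}. compositions A (m - j))"
      by (auto simp: compositions_def PiE_iff extensional_def)
  next
    fix p assume "p \<in> (SIGMA j:{..m}. compositions A (m - j))"
    then obtain j g where p: "p = (j, g)" "j \<le> m" and g: "g \<in> A \<rightarrow>\<^sub>E UNIV"
      and s: "(\<Sum>i\<in>A. g i) = m - j"
      by (auto simp: compositions_def)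
    have "(\<Sum>i\<in>A. (g(a := j)) i) = (\<Sum>i\<in>A. g i)"
      using assms by (intro sum.cong) auto
    with p g s assms show "(case p of (j, g) \<Rightarrow> g(a := j)) \<in> compositions (insert a A) m"
      by (auto simp: compositions_def PiE_iff extensional_def)
    from g assms have "g a = undefined" by (auto simp: PiE_iff extensional_def)
    with p show "((case p of (j, g) \<Rightarrow> g(a := j)) a,
        (case p of (j, g) \<Rightarrow> g(a := j))(a := undefined)) = p"
      by auto
  qed auto
  also have "\<dots> = (\<Sum>j\<le>m. \<Sum>g\<in>compositions A (m - j). h (g(a := j)))"
    using assms by (subst sum.Sigma) (auto simp: finite_compositions)
  finally show ?thesis .
qed

text \<open>
  By induction on \<open>A\<close>: split off one summand with the binomial theorem and use
  \<open>m! / (j! * P) = (m choose j) * ((m - j)! / P)\<close>, where \<open>P\<close> is the product of the other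
  factorials.
\<close>

theorem multinomial:
  fixes f :: "'i \<Rightarrow> 'a::comm_semiring_1"
  assumes "finite A"
  shows "(\<Sum>i\<in>A. f i) ^ m =
    (\<Sum>b\<in>compositions A m. of_nat (fact m div (\<Prod>i\<in>A. fact (b i))) * (\<Prod>i\<in>A. f i ^ b i))"
  using assms
proof (induction A arbitrary: m rule: finite_induct)
  case empty
  show ?case by (cases m) (auto simp: compositions_def)
next
  case (insert a A)
  let ?M = "\<lambda>A b. fact (\<Sum>i\<in>A. b i) div (\<Prod>i\<in>A. fact (b i)) :: nat"
  have step: "of_nat (m choose j) * f a ^ j * (of_nat (fact (m - j) div (\<Prod>i\<in>A. fact (g i)))
        * (\<Prod>i\<in>A. f i ^ g i)) =
      of_nat (fact m div (\<Prod>i\<in>insert a A. fact ((g(a := j)) i)))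
        * (\<Prod>i\<in>insert a A. f i ^ (g(a := j)) i)"
    if j: "j \<le> m" and g: "g \<in> compositions A (m - j)" for j g
  proof -
    define P where "P = (\<Prod>i\<in>A. fact (g i) :: nat)"
    have "P dvd fact (m - j)"
      using prod_fact_dvd_fact_sum[OF insert.hyps(1), of g] g
      by (auto simp: P_def compositions_def)
    then obtain q where q: "fact (m - j) = P * q" by (elim dvdE)
    have P: "P > 0" unfolding P_def by (simp add: prod_pos)
    have "fact m = fact j * fact (m - j) * (m choose j)"
      using binomial_fact_lemma[OF j] by simp
    also have "\<dots> = (fact j * P) * ((m choose j) * q)"
      by (simp add: q)
    finally have "fact m div (fact j * P) = (m choose j) * q"
      using P by simp
    moreover have "fact (m - j) div P = q" using P q by simp
    moreover have "(\<Prod>i\<in>A. fact ((g(a := j)) i)) = P"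
      "(\<Prod>i\<in>A. f i ^ (g(a := j)) i) = (\<Prod>i\<in>A. f i ^ g i)"
      unfolding P_def using insert.hyps by (auto intro!: prod.cong)
    ultimately show ?thesis
      using insert.hyps by (simp add: P_def[symmetric] mult_ac)
  qed
  have "(\<Sum>i\<in>insert a A. f i) ^ m =
      (\<Sum>j\<le>m. of_nat (m choose j) * f a ^ j * (\<Sum>i\<in>A. f i) ^ (m - j))"
    using insert.hyps by (simp add: binomial_ring)
  also have "\<dots> = (\<Sum>j\<le>m. \<Sum>g\<in>compositions A (m - j).
      of_nat (fact m div (\<Prod>i\<in>insert a A. fact ((g(a := j)) i)))
        * (\<Prod>i\<in>insert a A. f i ^ (g(a := j)) i))"
    unfolding insert.IH sum_distrib_left by (intro sum.cong refl step) auto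
  also have "\<dots> = (\<Sum>b\<in>compositions (insert a A) m.
      of_nat (fact m div (\<Prod>i\<in>insert a A. fact (b i))) * (\<Prod>i\<in>insert a A. f i ^ b i))"
    using insert.hyps by (rule sum_compositions_insert[symmetric])
  finally show ?case .
qed

section \<open>Coefficients of powers of an even power series\<close>

lemma fps_power_nth_cong:
  fixes f g :: "'a::comm_semiring_1 fps"
  assumes "\<And>i. i \<le> n \<Longrightarrow> f $ i = g $ i"
  shows "(f ^ m) $ n = (g ^ m) $ n"
  using assms
proof (induction m arbitrary: n)
  case (Suc m)
  show ?case
    unfolding power_Suc fps_mult_nth
    by (intro sum.cong refl arg_cong2[where f = "(*)"] Suc) (use Suc.prems in auto)
qed simp

text \<open>
  Only the coefficients of \<open>f\<close> up to \<open>2 * k\<close> matter, so \<open>f\<close> may be replaced by a polynomial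
  with \<open>k\<close> monomials of even exponent. In the multinomial expansion of its power, the tuple
  \<open>b\<close> contributes one monomial, of exponent \<open>2 * (\<Sum>r = 1..k. r * b r)\<close>; the weight
  condition selects those of exponent \<open>2 * k\<close>.
\<close>

lemma even_fps_power_nth:
  fixes f :: "'a::field_char_0 fps"
  assumes f0: "f $ 0 = 0" and odd: "\<And>i. odd i \<Longrightarrow> f $ i = 0"
  shows "(f ^ m) $ (2 * k) = (\<Sum>b \<in> {b \<in> weighted_tuples k. (\<Sum>r = 1..k. b r) = m}.
      fact m / (\<Prod>r = 1..k. fact (b r)) * (\<Prod>r = 1..k. (f $ (2 * r)) ^ b r))"
proof -
  define t where "t r = fps_const (f $ (2 * r)) * fps_X ^ (2 * r)" for r
  have trunc: "f $ i = (\<Sum>r = 1..k. t r) $ i" if "i \<le> 2 * k" for i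
  proof (cases "even i \<and> i \<noteq> 0")
    case True
    then obtain s where "i = 2 * s" by (elim conjE evenE)
    with True that have s: "i = 2 * s" "s \<in> {1..k}" by auto
    have "(\<Sum>r = 1..k. t r) $ i = (\<Sum>r = 1..k. if r = s then f $ i else 0)"
      unfolding fps_sum_nth t_def using s by (intro sum.cong) auto
    with s show ?thesis by simp
  next
    case False
    have "t r $ i = 0" if "r \<in> {1..k}" for r
      using False that by (auto simp: t_def)
    with False show ?thesis using f0 odd by (auto simp: fps_sum_nth)
  qed
  have term_nth: "(of_nat N * (\<Prod>r = 1..k. t r ^ b r)) $ (2 * k) =
      (if (\<Sum>r = 1..k. r * b r) = k then of_nat N * (\<Prod>r = 1..k. (f $ (2 * r)) ^ b r) else 0)"
    for N and b :: "nat \<Rightarrow> nat"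
  proof -
    have "(\<Prod>r = 1..k. t r ^ b r) = (\<Prod>r = 1..k. fps_const ((f $ (2 * r)) ^ b r)) *
        fps_X ^ (2 * (\<Sum>r = 1..k. r * b r))"
      unfolding t_def
      by (simp add: power_mult_distrib prod.distrib fps_const_power power_sum sum_distrib_left
          mult.assoc flip: power_mult)
    also have "(\<Prod>r = 1..k. fps_const ((f $ (2 * r)) ^ b r)) =
        fps_const (\<Prod>r = 1..k. (f $ (2 * r)) ^ b r)"
      by (induction k) (simp_all add: fps_const_mult[symmetric] del: fps_const_mult)
    finally have "of_nat N * (\<Prod>r = 1..k. t r ^ b r) =
        fps_const (of_nat N * (\<Prod>r = 1..k. (f $ (2 * r)) ^ b r)) *
        fps_X ^ (2 * (\<Sum>r = 1..k. r * b r))"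
      by (simp add: fps_of_nat[symmetric] mult.assoc flip: fps_const_mult)
    thus ?thesis by auto
  qed
  have "(f ^ m) $ (2 * k) = ((\<Sum>r = 1..k. t r) ^ m) $ (2 * k)"
    by (rule fps_power_nth_cong) (rule trunc)
  also have "\<dots> = (\<Sum>b\<in>compositions {1..k} m. if (\<Sum>r = 1..k. r * b r) = k
      then of_nat (fact m div (\<Prod>r = 1..k. fact (b r))) * (\<Prod>r = 1..k. (f $ (2 * r)) ^ b r) else 0)"
    by (simp only: multinomial[OF finite_atLeastAtMost] fps_sum_nth term_nth)
  also have "\<dots> = (\<Sum>b \<in> {b \<in> compositions {1..k} m. (\<Sum>r = 1..k. r * b r) = k}.
      of_nat (fact m div (\<Prod>r = 1..k. fact (b r))) * (\<Prod>r = 1..k. (f $ (2 * r)) ^ b r))"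
    by (rule sum.inter_filter[symmetric]) (simp add: finite_compositions)
  also have "\<dots> = (\<Sum>b \<in> {b \<in> weighted_tuples k. (\<Sum>r = 1..k. b r) = m}.
      fact m / (\<Prod>r = 1..k. fact (b r)) * (\<Prod>r = 1..k. (f $ (2 * r)) ^ b r))"
  proof (rule sum.cong)
    fix b assume b: "b \<in> {b \<in> weighted_tuples k. (\<Sum>r = 1..k. b r) = m}"
    have "(\<Prod>r = 1..k. fact (b r)) dvd (fact m :: nat)"
      using prod_fact_dvd_fact_sum[of "{1..k}" b] b by simp
    then obtain q :: nat where q: "fact m = (\<Prod>r = 1..k. fact (b r)) * q" by (elim dvdE)
    have "(fact m :: 'a) = (\<Prod>r = 1..k. fact (b r)) * of_nat q"
      using arg_cong[OF q, of "of_nat :: nat \<Rightarrow> 'a"] by (simp only: of_nat_mult of_nat_prod of_nat_fact)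
    hence "of_nat (fact m div (\<Prod>r = 1..k. fact (b r))) = (fact m / (\<Prod>r = 1..k. fact (b r)) :: 'a)"
      by (simp add: q)
    thus "of_nat (fact m div (\<Prod>r = 1..k. fact (b r))) * (\<Prod>r = 1..k. (f $ (2 * r)) ^ b r) =
      fact m / (\<Prod>r = 1..k. fact (b r)) * (\<Prod>r = 1..k. (f $ (2 * r)) ^ b r)"
      by (simp add: of_nat_fact)
  qed (auto simp: compositions_def weighted_tuples_def)
  finally show ?thesis .
qed

section \<open>Chebyshev-type polynomials at the hyperbolic cosine\<close>

text \<open>
  The series of \<open>2 * cosh (a * t)\<close>. The factor 2 keeps the product formula below free of
  denominators.
\<close>

definition two_cosh :: "real \<Rightarrow> real fps" where
  "two_cosh a = fps_exp a + fps_exp (- a)"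

lemma two_cosh_nth: "two_cosh a $ n = (if even n then 2 * a ^ n / fact n else 0)"
  by (simp add: two_cosh_def)

lemma two_cosh_0: "two_cosh 0 = 2"
  by (simp add: two_cosh_def)

lemma two_cosh_mult: "two_cosh a * two_cosh b = two_cosh (a + b) + two_cosh (a - b)"
proof -
  have "two_cosh (a + b) + two_cosh (a - b) =
      (fps_exp (a + b) + fps_exp (- a + - b)) + (fps_exp (a + - b) + fps_exp (- a + b))"
    by (simp add: two_cosh_def algebra_simps)
  also have "\<dots> = two_cosh a * two_cosh b"
    unfolding fps_exp_add_mult two_cosh_def by (simp add: algebra_simps)
  finally show ?thesis by simp
qed

text \<open>
  For \<open>N \<ge> 1\<close> this is \<open>U\<^sub>N\<^sub>-\<^sub>1(1 + y / 2)\<close> for the Chebyshev polynomials \<open>U\<close> of the second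
  kind, so that \<open>y = 2 * cosh \<theta> - 2\<close> gives \<open>sinh (N * \<theta>) / sinh \<theta>\<close>.
\<close>

definition cheb :: "'a::comm_ring_1 \<Rightarrow> nat \<Rightarrow> 'a" where
  "cheb y N = (\<Sum>m<N. of_nat ((N + m) choose (2 * m + 1)) * y ^ m)"

text \<open>
  The terms with \<open>m \<ge> N\<close> vanish. A common bound makes polynomials of different \<open>N\<close> comparable
  term by term.
\<close>

lemma cheb_extend:
  assumes "N \<le> M"
  shows "cheb y N = (\<Sum>m<M. of_nat ((N + m) choose (2 * m + 1)) * y ^ m)"
  unfolding cheb_def using assms by (intro sum.mono_neutral_left) (auto simp: binomial_eq_0)

lemma binomial_second_difference:
  "(Suc (Suc a) choose Suc (Suc q)) + (a choose Suc (Suc q)) =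
    2 * (Suc a choose Suc (Suc q)) + (a choose q)"
  by simp

text \<open>
  Compare coefficients of \<open>y\<^sup>m\<close>: raising the index \<open>m\<close> by one raises the lower binomial entry
  by two, so the factor \<open>y\<close> turns the second difference in \<open>N\<close> into an index shift.
\<close>

lemma cheb_rec: "cheb y (N + 2) + cheb y N = (2 + y) * cheb y (N + 1)"
proof -
  let ?c = "\<lambda>N m. of_nat ((N + m) choose (2 * m + 1)) :: 'a"
  have pascal: "?c (N + 2) (Suc m) + ?c N (Suc m) = 2 * ?c (N + 1) (Suc m) + ?c (N + 1) m" for m
  proof -
    have "((N + 2 + Suc m) choose (2 * Suc m + 1)) + ((N + Suc m) choose (2 * Suc m + 1)) =
        2 * ((N + 1 + Suc m) choose (2 * Suc m + 1)) + ((N + 1 + m) choose (2 * m + 1))"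
      using binomial_second_difference[of "N + Suc m" "2 * m + 1"]
      by (simp del: binomial_Suc_Suc)
    from arg_cong[OF this, of "of_nat :: nat \<Rightarrow> 'a"] show ?thesis
      by (simp only: of_nat_add of_nat_mult of_nat_numeral)
  qed
  have split: "(\<Sum>m<N + 2. h m) = h 0 + (\<Sum>m<N + 1. h (Suc m))" for h :: "nat \<Rightarrow> 'a"
    using sum.lessThan_Suc_shift[of h "N + 1"] by simp
  have "cheb y (N + 2) + cheb y N = (\<Sum>m<N + 2. (?c (N + 2) m + ?c N m) * y ^ m)"
    unfolding cheb_extend[OF le_add1[of N 2]] cheb_def[of y "N + 2"] sum.distrib[symmetric]
      distrib_right ..
  also have "\<dots> = 2 * ?c (N + 1) 0 + (\<Sum>m<N + 1. (2 * ?c (N + 1) (Suc m) + ?c (N + 1) m) * y ^ Suc m)"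
    unfolding split pascal by simp
  also have "(\<Sum>m<N + 1. (2 * ?c (N + 1) (Suc m) + ?c (N + 1) m) * y ^ Suc m) =
      (\<Sum>m<N + 1. 2 * (?c (N + 1) (Suc m) * y ^ Suc m) + y * (?c (N + 1) m * y ^ m))"
    by (intro sum.cong refl) (simp only: power_Suc ring_distribs mult_ac)
  also have "2 * ?c (N + 1) 0 + \<dots> =
      2 * (?c (N + 1) 0 * y ^ 0 + (\<Sum>m<N + 1. ?c (N + 1) (Suc m) * y ^ Suc m))
      + y * (\<Sum>m<N + 1. ?c (N + 1) m * y ^ m)"
    by (simp only: sum.distrib sum_distrib_left[symmetric] distrib_left power_0 mult_1_right add.assoc)
  also have "?c (N + 1) 0 * y ^ 0 + (\<Sum>m<N + 1. ?c (N + 1) (Suc m) * y ^ Suc m) = cheb y (N + 1)"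
    unfolding split[of "\<lambda>m. ?c (N + 1) m * y ^ m", symmetric]
    by (rule cheb_extend[symmetric]) simp
  also have "(\<Sum>m<N + 1. ?c (N + 1) m * y ^ m) = cheb y (N + 1)"
    by (simp only: cheb_def)
  finally show ?thesis by (simp only: distrib_right)
qed

lemma cheb_0: "cheb y 0 = 0" and cheb_1: "cheb y 1 = 1"
  by (simp_all add: cheb_def)

lemma cheb_2: "cheb y 2 = 2 + y"
  using cheb_rec[of y 0] cheb_0[of y] cheb_1[of y] by (simp add: numeral_2_eq_2)

text \<open>
  In terms of \<open>sinh\<close> this is
  \<open>sinh ((N + 2) * \<theta>) - sinh (N * \<theta>) = 2 * cosh ((N + 1) * \<theta>) * sinh \<theta>\<close> with \<open>\<theta> = t / 2\<close>.
  The proof avoids the quotient by \<open>sinh \<theta>\<close>: both sides satisfy the same three-term recurrence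
  in \<open>N\<close> and agree for \<open>N = 0\<close> and \<open>N = 1\<close>.
\<close>

lemma cheb_diff_two_cosh:
  assumes y: "2 + y = two_cosh (1 / 2)"
  shows "cheb y (N + 2) - cheb y N = two_cosh ((real N + 1) / 2)"
proof (induction N rule: less_induct)
  case (less N)
  consider "N = 0" | "N = 1" | M where "N = M + 2"
    by (metis One_nat_def add_2_eq_Suc' old.nat.exhaust)
  thus ?case
  proof cases
    case 1
    thus ?thesis using y by (simp add: cheb_0 cheb_2[unfolded numeral_2_eq_2])
  next
    case 2
    have "cheb y 3 + 1 = two_cosh (1 / 2) * two_cosh (1 / 2)"
      using cheb_rec[of y 1] unfolding y[symmetric]
      by (simp add: cheb_1[unfolded One_nat_def] cheb_2[unfolded numeral_2_eq_2] numeral_eq_Suc)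
    also have "\<dots> = two_cosh 1 + 2"
      unfolding two_cosh_mult by (simp add: two_cosh_0)
    finally have "cheb y 3 - 1 = two_cosh 1" by (simp add: algebra_simps)
    thus ?thesis using 2 cheb_1[of y] by (simp add: numeral_eq_Suc)
  next
    case 3
    have IH1: "cheb y (M + 3) - cheb y (M + 1) = two_cosh ((real M + 2) / 2)"
      using less.IH[of "M + 1"] 3 by (simp add: numeral_eq_Suc add.commute)
    have IH0: "cheb y (M + 2) - cheb y M = two_cosh ((real M + 1) / 2)"
      using less.IH[of M] 3 by simp
    have "(cheb y (M + 4) - cheb y (M + 2)) + (cheb y (M + 2) - cheb y M) =
        (2 + y) * (cheb y (M + 3) - cheb y (M + 1))"
      using cheb_rec[of y M] cheb_rec[of y "M + 2"]
      by (simp add: algebra_simps numeral_eq_Suc)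
    also have "\<dots> = two_cosh ((real M + 2) / 2) * two_cosh (1 / 2)"
      unfolding IH1 y by (rule mult.commute)
    also have "\<dots> = two_cosh ((real M + 3) / 2) + two_cosh ((real M + 1) / 2)"
      unfolding two_cosh_mult by (simp add: add.commute flip: add_divide_distrib diff_divide_distrib)
    finally have "cheb y (M + 2 + 2) - cheb y (M + 2) = two_cosh ((real M + 3) / 2)"
      unfolding IH0 by (simp add: numeral_eq_Suc)
    thus ?thesis unfolding 3 by (simp add: add.commute)
  qed
qed

lemma cheb_odd_two_cosh:
  assumes "2 + y = two_cosh (1 / 2)"
  shows "cheb y (2 * n + 1) = 1 + (\<Sum>i = 1..n. two_cosh (real i))"
proof (induction n)
  case 0
  show ?case by (simp add: cheb_def)
next
  case (Suc n)
  have "(real (2 * n + 1) + 1) / 2 = real (Suc n)" by simp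
  moreover have "2 * Suc n + 1 = 2 * n + 1 + 2" by simp
  ultimately have "cheb y (2 * Suc n + 1) - cheb y (2 * n + 1) = two_cosh (real (Suc n))"
    using cheb_diff_two_cosh[OF assms, of "2 * n + 1"] by (simp only:)
  with Suc show ?case by (simp add: algebra_simps)
qed

section \<open>The power sum formula\<close>

theorem theorem2:
  fixes n k :: nat
  assumes "n \<ge> 1" and "k \<ge> 1"
  shows "real (power_sum n (2 * k)) =
    1 / 2 * (\<Sum>b \<in> weighted_tuples k.
      let m = (\<Sum>r = 1..k. b r) in
        fact (2 * k) / (\<Prod>r = 1..k. fact (b r))
        * (\<Prod>r = 1..k. (1 / (4 ^ r * fact (2 * r))) ^ b r)
        * 2 ^ m * fact m * real ((2 * n + m + 1) choose (2 * m + 1)))"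
proof -
  \<comment> \<open>\<open>c = cosh (t / 2) - 1\<close>, the series \<open>\<Sum>r \<ge> 1. t\<^sup>2\<^sup>r / (4\<^sup>r * (2 * r)!)\<close>\<close>
  define c :: "real fps" where "c = fps_const (1 / 2) * two_cosh (1 / 2) - 1"
  define y where "y = fps_const 2 * c"
  have "2 + y = two_cosh (1 / 2)"
    by (simp add: fps_eq_iff y_def c_def fps_numeral_nth algebra_simps)
  hence cheb: "cheb y (2 * n + 1) = 1 + (\<Sum>i = 1..n. two_cosh (real i))"
    by (rule cheb_odd_two_cosh)
  have c_even: "c $ (2 * r) = 1 / (4 ^ r * fact (2 * r))" if "r \<in> {1..k}" for r
    using that by (simp add: c_def two_cosh_nth power_mult power_divide)
  define s where "s b = (\<Sum>r = 1..k. b r)" for b :: "nat \<Rightarrow> nat"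
  define G :: "(nat \<Rightarrow> nat) \<Rightarrow> real" where "G b = fact (s b) / (\<Prod>r = 1..k. fact (b r))
    * (\<Prod>r = 1..k. (1 / (4 ^ r * fact (2 * r))) ^ b r)" for b
  define T where "T b = real ((2 * n + s b + 1) choose (2 * s b + 1)) * (2 ^ s b * G b)" for b
  have y_nth: "(y ^ m) $ (2 * k) = (\<Sum>b \<in> {b \<in> weighted_tuples k. s b = m}. 2 ^ s b * G b)" for m
  proof -
    have "c $ 0 = 0" "\<And>i. odd i \<Longrightarrow> c $ i = 0"
      by (auto simp: c_def two_cosh_nth elim!: oddE)
    hence "(c ^ m) $ (2 * k) = (\<Sum>b \<in> {b \<in> weighted_tuples k. s b = m}.
        fact m / (\<Prod>r = 1..k. fact (b r)) * (\<Prod>r = 1..k. (c $ (2 * r)) ^ b r))"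
      unfolding s_def by (rule even_fps_power_nth)
    also have "\<dots> = (\<Sum>b \<in> {b \<in> weighted_tuples k. s b = m}. G b)"
      unfolding G_def by (intro sum.cong arg_cong2[where f = "(*)"] prod.cong) (auto simp: c_even)
    finally have "(c ^ m) $ (2 * k) = (\<Sum>b \<in> {b \<in> weighted_tuples k. s b = m}. G b)" .
    thus ?thesis
      by (simp add: y_def power_mult_distrib fps_const_power sum_distrib_left)
  qed
  \<comment> \<open>Tuples with \<open>m > 2 * n\<close> contribute nothing, since the binomial coefficient vanishes;
    the others are grouped by \<open>m\<close>.\<close>
  let ?W = "{b \<in> weighted_tuples k. s b < 2 * n + 1}"
  have "(\<Sum>b \<in> weighted_tuples k. T b) = (\<Sum>b \<in> ?W. T b)"
    by (rule sum.mono_neutral_right)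
      (auto simp: finite_weighted_tuples T_def binomial_eq_0 simp del: binomial_Suc_Suc)
  also have "\<dots> = (\<Sum>m<2 * n + 1. \<Sum>b \<in> {b \<in> ?W. s b = m}. T b)"
    by (rule sum.group[symmetric]) (auto simp: finite_weighted_tuples)
  also have "\<dots> = (\<Sum>m<2 * n + 1. real ((2 * n + m + 1) choose (2 * m + 1)) * (y ^ m) $ (2 * k))"
    unfolding y_nth sum_distrib_left T_def by (intro sum.cong) auto
  also have "\<dots> = cheb y (2 * n + 1) $ (2 * k)"
    by (simp add: cheb_def fps_sum_nth fps_of_nat[symmetric])
  also have "\<dots> = (\<Sum>i = 1..n. 2 * real i ^ (2 * k) / fact (2 * k))"
    unfolding cheb using \<open>k \<ge> 1\<close> by (simp add: fps_sum_nth two_cosh_nth)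
  also have "\<dots> = 2 * real (power_sum n (2 * k)) / fact (2 * k)"
    by (simp add: power_sum_def sum_divide_distrib sum_distrib_left)
  finally have "real (power_sum n (2 * k)) = 1 / 2 * (\<Sum>b \<in> weighted_tuples k. fact (2 * k) * T b)"
    unfolding sum_distrib_left[symmetric] by (simp add: field_simps)
  also have "(\<Sum>b \<in> weighted_tuples k. fact (2 * k) * T b) =
    (\<Sum>b \<in> weighted_tuples k.
      let m = (\<Sum>r = 1..k. b r) in
        fact (2 * k) / (\<Prod>r = 1..k. fact (b r))
        * (\<Prod>r = 1..k. (1 / (4 ^ r * fact (2 * r))) ^ b r)
        * 2 ^ m * fact m * real ((2 * n + m + 1) choose (2 * m + 1)))"
    by (intro sum.cong) (simp_all add: T_def G_def s_def Let_def mult_ac)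
  finally show ?thesis .
qed

end
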